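(* Let $(\mathbb{P},\le)$ be the countable universal homogeneous partially ordered set. Let $\mathbf{B}$ be a countable structure with carrier $B$ such that $\operatorname{End}(\mathbf{B})$ has only finitely many weak orbits on $B$, and let $h\colon \operatorname{End}(\mathbb{P},\le)\to\operatorname{End}(\mathbf{B})$ be a monoid-isomorphism. Then $h$ is a homeomorphism.
   Context: A structure means a relational structure: a set $B$ (the carrier) with a family of finitary relations on $B$ indexed by an arbitrary relational signature. $\operatorname{End}(\mathbf{B})$ is the monoid, under composition, of all endomorphisms of $\mathbf{B}$, i.e. of all maps $B\to B$ preserving every basic relation. The countable universal homogeneous poset $(\mathbb{P},\le)$ (with non-strict order $\le$) is the (up to isomorphism unique) countable partially ordered set into which every finite poset embeds and in which every isomorphism between finite subposets extends to an automorphism of $(\mathbb{P},\le)$. $\operatorname{End}(\mathbb{P},\le)$ is the monoid of its order-preserving selfmaps. For a set $B$, let $\mathfrak{T}_B$ be the monoid of all maps $B\to B$. It carries the topology of pointwise convergence (the product topology on $B^B$ with $B$ discrete), and every submonoid of $\mathfrak{T}_B$ (such as $\operatorname{End}(\mathbf{B})$) carries the subspace topology. Weak orbits: for a transformation monoid $\mathfrak{M}\le\mathfrak{T}_B$ and $a,b\in B$, put $a\preceq b$ if there is $m\in\mathfrak{M}$ with $m(b)=a$. The weak orbits of $\mathfrak{M}$ on $B$ are the classes of the least equivalence relation on $B$ containing $\preceq$. *)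

theory Defs
  imports "HOL-Analysis.Function_Topology" "HOL-Algebra.Group" "HOL-Library.Countable_Set"
begin

text \<open>
  Structures and posets live on carrier \<^emph>\<open>sets\<close>.  A selfmap of a set \<open>B\<close> is represented by its
  unique extensional representative, an element of \<open>B \<rightarrow>\<^sub>E B\<close>, so that equality of
  selfmaps is equality of HOL functions; the composition of two such maps is \<open>compose B\<close>.
\<close>

subsection \<open>Transformation monoids and the topology of pointwise convergence\<close>

definition transf_monoid :: "'b set \<Rightarrow> ('b \<Rightarrow> 'b) set \<Rightarrow> ('b \<Rightarrow> 'b) monoid" where
  "transf_monoid B M = \<lparr>carrier = M, mult = compose B, one = (\<lambda>x\<in>B. x)\<rparr>"

definition pointwise_topology :: "'b set \<Rightarrow> ('b \<Rightarrow> 'b) set \<Rightarrow> ('b \<Rightarrow> 'b) topology" where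
  "pointwise_topology B M = subtopology (product_topology (\<lambda>_. discrete_topology B) B) M"

text \<open>Every isomorphism in the sense of \<^const>\<open>iso\<close> preserves the unit, being a surjective
  multiplicative map between monoids; so for monoids \<^const>\<open>iso\<close> is monoid isomorphism.\<close>

subsection \<open>Weak orbits\<close>

definition weak_orbit_le :: "'b set \<Rightarrow> ('b \<Rightarrow> 'b) set \<Rightarrow> 'b rel" where
  "weak_orbit_le B M = {(a, b). a \<in> B \<and> b \<in> B \<and> (\<exists>m\<in>M. m b = a)}"

definition weak_orbit_rel :: "'b set \<Rightarrow> ('b \<Rightarrow> 'b) set \<Rightarrow> 'b rel" where
  "weak_orbit_rel B M = \<Inter>{E. equiv B E \<and> weak_orbit_le B M \<subseteq> E}"

definition weak_orbits :: "'b set \<Rightarrow> ('b \<Rightarrow> 'b) set \<Rightarrow> 'b set set" where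
  "weak_orbits B M = B // weak_orbit_rel B M"

subsection \<open>Relational structures\<close>

text \<open>The signature is a set \<open>S\<close> of relation symbols with arities \<open>ar\<close>; tuples are lists.\<close>

definition relational_structure ::
    "'b set \<Rightarrow> 's set \<Rightarrow> ('s \<Rightarrow> nat) \<Rightarrow> ('s \<Rightarrow> 'b list set) \<Rightarrow> bool" where
  "relational_structure B S ar R \<longleftrightarrow>
     (\<forall>s\<in>S. R s \<subseteq> {xs. length xs = ar s \<and> set xs \<subseteq> B})"

definition structure_End :: "'b set \<Rightarrow> 's set \<Rightarrow> ('s \<Rightarrow> 'b list set) \<Rightarrow> ('b \<Rightarrow> 'b) set" where
  "structure_End B S R = {f \<in> B \<rightarrow>\<^sub>E B. \<forall>s\<in>S. \<forall>xs\<in>R s. map f xs \<in> R s}"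

subsection \<open>The countable universal homogeneous poset\<close>

definition order_iso :: "'a set \<Rightarrow> 'a rel \<Rightarrow> 'b set \<Rightarrow> 'b rel \<Rightarrow> ('a \<Rightarrow> 'b) \<Rightarrow> bool" where
  "order_iso A r C s f \<longleftrightarrow>
     bij_betw f A C \<and> (\<forall>x\<in>A. \<forall>y\<in>A. (x, y) \<in> r \<longleftrightarrow> (f x, f y) \<in> s)"

text \<open>Universality is stated for finite posets with carrier in \<^typ>\<open>nat\<close>; up to isomorphism
  these are all finite posets.\<close>

definition universal_poset :: "'a set \<Rightarrow> 'a rel \<Rightarrow> bool" where
  "universal_poset P r \<longleftrightarrow>
     (\<forall>(A :: nat set) s. finite A \<longrightarrow> partial_order_on A s \<longrightarrow>
        (\<exists>C e. C \<subseteq> P \<and> order_iso A s C r e))"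

definition homogeneous_poset :: "'a set \<Rightarrow> 'a rel \<Rightarrow> bool" where
  "homogeneous_poset P r \<longleftrightarrow>
     (\<forall>A C f. A \<subseteq> P \<longrightarrow> C \<subseteq> P \<longrightarrow> finite A \<longrightarrow> finite C \<longrightarrow> order_iso A r C r f \<longrightarrow>
        (\<exists>g. order_iso P r P r g \<and> (\<forall>x\<in>A. g x = f x)))"

definition countable_universal_homogeneous_poset :: "'a set \<Rightarrow> 'a rel \<Rightarrow> bool" where
  "countable_universal_homogeneous_poset P r \<longleftrightarrow>
     partial_order_on P r \<and> countable P \<and> universal_poset P r \<and> homogeneous_poset P r"

definition poset_End :: "'a set \<Rightarrow> 'a rel \<Rightarrow> ('a \<Rightarrow> 'a) set" where
  "poset_End P r =
     {f \<in> P \<rightarrow>\<^sub>E P. monotone_on P (\<lambda>x y. (x, y) \<in> r) (\<lambda>x y. (x, y) \<in> r) f}"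

end

theory Submission
  imports Defs "HOL-Library.Sublist"
begin

text \<open>
  Continuity of \<open>h\<close> comes from the countability of \<open>B\<close>: every multiplicative map from \<open>End P\<close> into
  the selfmaps of a countable set is continuous (\<open>hom_locally_constant\<close>).  The engine is a supply of
  endomorphisms \<open>e\<^sub>x\<close> of \<open>P\<close>, one for each binary sequence \<open>x\<close>, which are so independent that any two
  endomorphisms \<open>f\<close>, \<open>g\<close> agreeing on the first points of an enumeration of \<open>P\<close> arise as
  \<open>f = k \<circ> e\<^sub>x\<close> and \<open>g = k \<circ> e\<^sub>y\<close> with a common \<open>k\<close>, whenever \<open>x\<close> and \<open>y\<close> first differ at the matching
  place (\<open>independent_endomorphisms\<close>).  There are uncountably many sequences, so for each \<open>b \<in> B\<close> two
  of them satisfy \<open>h e\<^sub>x b = h e\<^sub>y b\<close>; applying \<open>h k\<close> gives \<open>h f b = h g b\<close>.  Hence the value of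
  \<open>h f\<close> at \<open>b\<close> depends only on a finite part of \<open>f\<close>.

  The \<open>e\<^sub>x\<close> are the branches of a binary tree of copies of \<open>P\<close>, glued freely along common initial
  parts.  This tree is a countable ordered set, on which \<open>f\<close> and \<open>g\<close> can be played on different
  branches.  What makes it usable inside \<open>P\<close> is that every countable preorder maps into \<open>P\<close> so
  freely that each monotone map from it to \<open>P\<close> factors through an endomorphism of \<open>P\<close>
  (\<open>free_map_into_poset\<close>).

  Continuity of the inverse uses the constant maps \<open>c\<^sub>p\<close>.  They are left zeros of \<open>End P\<close>, so
  \<open>h c\<^sub>p\<close> is a left zero of \<open>End B\<close> and therefore constant on each weak orbit.  With finitely many weak
  orbits the condition \<open>f p = q\<close>, which says \<open>f \<circ> c\<^sub>p = c\<^sub>q\<close>, becomes a condition on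
  finitely many values of \<open>h f\<close>.
\<close>

section \<open>Interpolation in the universal homogeneous poset\<close>

text \<open>
  What the constructions below draw from universality and homogeneity: any consistent pair of
  finite sets of bounds is met by a point that is comparable to members of a given finite set \<open>D\<close> only
  where the bounds force it.
\<close>

locale interpolating_poset =
  fixes P :: "'p set" and le :: "'p rel"
  assumes partial_order: "partial_order_on P le"
    and countable_carrier: "countable P"
    and interpolate: "\<lbrakk>finite D; D \<subseteq> P; L \<subseteq> D; U \<subseteq> D; \<And>l u. l \<in> L \<Longrightarrow> u \<in> U \<Longrightarrow> (l, u) \<in> le\<rbrakk> \<Longrightarrow>
      \<exists>z\<in>P. (\<forall>l\<in>L. (l, z) \<in> le) \<and> (\<forall>u\<in>U. (z, u) \<in> le) \<and>
        (\<forall>d\<in>D. (d, z) \<in> le \<longrightarrow> (\<exists>l\<in>L. (d, l) \<in> le)) \<and>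
        (\<forall>d\<in>D. (z, d) \<in> le \<longrightarrow> (\<exists>u\<in>U. (u, d) \<in> le))"
begin

lemma le_refl: "x \<in> P \<Longrightarrow> (x, x) \<in> le"
  using partial_order_onD(1)[OF partial_order] by (auto simp: refl_on_def)

lemma le_trans: "(x, y) \<in> le \<Longrightarrow> (y, z) \<in> le \<Longrightarrow> (x, z) \<in> le"
  using partial_order_onD(2)[OF partial_order] by (rule transD)

lemma le_antisym: "(x, y) \<in> le \<Longrightarrow> (y, x) \<in> le \<Longrightarrow> x = y"
  using partial_order_onD(3)[OF partial_order] by (rule antisymD)

lemma ex_between:
  assumes "finite L" "finite U" "L \<subseteq> P" "U \<subseteq> P"
    and "\<And>l u. l \<in> L \<Longrightarrow> u \<in> U \<Longrightarrow> (l, u) \<in> le"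
  shows "\<exists>z\<in>P. (\<forall>l\<in>L. (l, z) \<in> le) \<and> (\<forall>u\<in>U. (z, u) \<in> le)"
  using interpolate[of "L \<union> U" L U] assms by blast

end

text \<open>
  If the bounds touch, their common element is the required point.  Otherwise adjoining an abstract
  point to \<open>D\<close> with the least possible order yields a finite poset; universality embeds it, and
  homogeneity moves the copy of \<open>D\<close> back onto \<open>D\<close>.
\<close>

lemma interpolating_poset_if_universal_homogeneous:
  fixes P :: "'p set" and le :: "'p rel"
  assumes "countable_universal_homogeneous_poset P le"
  shows "interpolating_poset P le"
proof
  have po: "partial_order_on P le" and cnt: "countable P"
    and univ: "universal_poset P le" and homog: "homogeneous_poset P le"
    using assms by (auto simp: countable_universal_homogeneous_poset_def)
  show "partial_order_on P le" "countable P" by (fact po cnt)+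
  have rfl: "(x, x) \<in> le" if "x \<in> P" for x
    using partial_order_onD(1)[OF po] that by (auto simp: refl_on_def)
  have tr: "(x, z) \<in> le" if "(x, y) \<in> le" "(y, z) \<in> le" for x y z
    using partial_order_onD(2)[OF po] that by (rule transD)
  have asym: "x = y" if "(x, y) \<in> le" "(y, x) \<in> le" for x y
    using partial_order_onD(3)[OF po] that by (rule antisymD)
  fix D L U :: "'p set"
  assume D: "finite D" "D \<subseteq> P" and LD: "L \<subseteq> D" and UD: "U \<subseteq> D"
    and LU: "\<And>l u. l \<in> L \<Longrightarrow> u \<in> U \<Longrightarrow> (l, u) \<in> le"
  show "\<exists>z\<in>P. (\<forall>l\<in>L. (l, z) \<in> le) \<and> (\<forall>u\<in>U. (z, u) \<in> le) \<and>
        (\<forall>d\<in>D. (d, z) \<in> le \<longrightarrow> (\<exists>l\<in>L. (d, l) \<in> le)) \<and>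
        (\<forall>d\<in>D. (z, d) \<in> le \<longrightarrow> (\<exists>u\<in>U. (u, d) \<in> le))"
  proof (cases "L \<inter> U = {}")
    case False
    then obtain z where "z \<in> L" "z \<in> U" by blast
    then show ?thesis using LU D LD by (intro bexI[of _ z]) auto
  next
    case disj: True
    \<comment> \<open>\<open>0\<close> codes the new point; the points of \<open>D\<close> get positive codes.\<close>
    define code where "code x = Suc (to_nat_on D x)" for x
    define A where "A = insert 0 (code ` D)"
    define s where "s = {(code x, code y) |x y. x \<in> D \<and> y \<in> D \<and> (x, y) \<in> le} \<union>
      {(code x, 0) |x. x \<in> D \<and> (\<exists>l\<in>L. (x, l) \<in> le)} \<union>
      {(0, code y) |y. y \<in> D \<and> (\<exists>u\<in>U. (u, y) \<in> le)} \<union> {(0, 0)}"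
    have code_eq: "code x = code y \<longleftrightarrow> x = y" if "x \<in> D" "y \<in> D" for x y
      using that D(1) by (simp add: code_def countable_finite)
    have s_code: "(code x, code y) \<in> s \<longleftrightarrow> (x, y) \<in> le" if "x \<in> D" "y \<in> D" for x y
      using that code_eq by (auto simp: s_def) (auto simp: code_def)
    have s_code0: "(code x, 0) \<in> s \<longleftrightarrow> (\<exists>l\<in>L. (x, l) \<in> le)" if "x \<in> D" for x
      using that code_eq by (auto simp: s_def) (auto simp: code_def)
    have s_0code: "(0, code y) \<in> s \<longleftrightarrow> (\<exists>u\<in>U. (u, y) \<in> le)" if "y \<in> D" for y
      using that code_eq by (auto simp: s_def) (auto simp: code_def)
    have s_00: "(0, 0) \<in> s" by (simp add: s_def)
    have sA: "s \<subseteq> A \<times> A" by (auto simp: s_def A_def)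
    have A_cases: "a = 0 \<or> (\<exists>x\<in>D. a = code x)" if "a \<in> A" for a
      using that by (auto simp: A_def)
    have "refl_on A s"
      using D rfl s_00 by (auto simp: refl_on_def A_def s_code)
    moreover have "trans s"
    proof (rule transI)
      fix a b c assume ab: "(a, b) \<in> s" and bc: "(b, c) \<in> s"
      have cases: "a = 0 \<or> (\<exists>x\<in>D. a = code x)" "b = 0 \<or> (\<exists>x\<in>D. b = code x)"
        "c = 0 \<or> (\<exists>x\<in>D. c = code x)" using ab bc sA A_cases by auto
      show "(a, c) \<in> s"
        using cases ab bc
        by (-, elim disjE bexE; simp add: s_code s_code0 s_0code s_00) (metis tr LU)+
    qed
    moreover have "antisym s"
    proof (rule antisymI)
      fix a b assume ab: "(a, b) \<in> s" and ba: "(b, a) \<in> s"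
      have no: False if "l \<in> L" "u \<in> U" "(x, l) \<in> le" "(u, x) \<in> le" for l u x
        using asym[of l u] LU[of l u] tr[of u x l] that disj by blast
      have cases: "a = 0 \<or> (\<exists>x\<in>D. a = code x)" "b = 0 \<or> (\<exists>x\<in>D. b = code x)"
        using ab sA A_cases by auto
      show "a = b"
        using cases ab ba
        by (-, elim disjE bexE; simp add: s_code s_code0 s_0code) (use no asym in blast)+
    qed
    ultimately have "partial_order_on A s"
      using sA by (simp add: partial_order_on_def preorder_on_def)
    moreover have "finite A" using D by (simp add: A_def)
    ultimately obtain C e where C: "C \<subseteq> P" and e: "order_iso A s C le e"
      using univ unfolding universal_poset_def by blast
    have e_le: "(e a, e b) \<in> le \<longleftrightarrow> (a, b) \<in> s" if "a \<in> A" "b \<in> A" for a b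
      using e that by (auto simp: order_iso_def)
    have eP: "e a \<in> P" if "a \<in> A" for a
      using e that C by (auto simp: order_iso_def bij_betw_def)
    have in_A: "0 \<in> A" "\<And>x. x \<in> D \<Longrightarrow> code x \<in> A" by (auto simp: A_def)
    define f where "f = (\<lambda>x. e (code x))"
    have f_le: "(f x, f y) \<in> le \<longleftrightarrow> (x, y) \<in> le" if "x \<in> D" "y \<in> D" for x y
      using that by (simp add: f_def e_le in_A s_code)
    have inj_f: "inj_on f D"
      by (rule inj_onI) (metis f_le asym rfl D(2) subsetD)
    have fD: "f ` D \<subseteq> P" using eP in_A by (auto simp: f_def)
    define f' where "f' = inv_into D f"
    have f'f: "f' (f x) = x" if "x \<in> D" for x
      using that inj_f by (simp add: f'_def)
    have "order_iso (f ` D) le D le f'"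
      unfolding order_iso_def
    proof (intro conjI ballI)
      show "bij_betw f' (f ` D) D"
        unfolding f'_def using inj_f by (simp add: bij_betw_inv_into inj_on_imp_bij_betw)
    qed (auto simp: f'f f_le)
    then obtain g where g: "order_iso P le P le g" and gf: "\<forall>x\<in>f ` D. g x = f' x"
      using homog D fD unfolding homogeneous_poset_def by (metis finite_imageI)
    have g_le: "(g x, g y) \<in> le \<longleftrightarrow> (x, y) \<in> le" if "x \<in> P" "y \<in> P" for x y
      using g that by (auto simp: order_iso_def)
    have gP: "g x \<in> P" if "x \<in> P" for x
      using g that by (auto simp: order_iso_def bij_betw_def)
    have gfx: "g (f x) = x" if "x \<in> D" for x using gf f'f that by simp
    have below: "(d, g (e 0)) \<in> le \<longleftrightarrow> (\<exists>l\<in>L. (d, l) \<in> le)" if "d \<in> D" for d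
    proof -
      have "(d, g (e 0)) \<in> le \<longleftrightarrow> (g (f d), g (e 0)) \<in> le" using gfx that by simp
      also have "\<dots> \<longleftrightarrow> (code d, 0) \<in> s"
        using that by (simp add: g_le eP in_A f_def e_le)
      finally show ?thesis using s_code0 that by simp
    qed
    have above: "(g (e 0), d) \<in> le \<longleftrightarrow> (\<exists>u\<in>U. (u, d) \<in> le)" if "d \<in> D" for d
    proof -
      have "(g (e 0), d) \<in> le \<longleftrightarrow> (g (e 0), g (f d)) \<in> le" using gfx that by simp
      also have "\<dots> \<longleftrightarrow> (0, code d) \<in> s"
        using that by (simp add: g_le eP in_A f_def e_le)
      finally show ?thesis using s_0code that by simp
    qed
    show ?thesis
    proof (intro bexI[of _ "g (e 0)"] conjI)
      show "\<forall>l\<in>L. (l, g (e 0)) \<in> le" using below LD D rfl by blast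
      show "\<forall>u\<in>U. (g (e 0), u) \<in> le" using above UD D rfl by blast
    qed (use below above gP eP in_A in auto)
  qed
qed

section \<open>Countable preorders map freely into the poset\<close>

context interpolating_poset
begin

lemma poset_EndI:
  assumes "\<And>x. x \<in> P \<Longrightarrow> f x \<in> P" "\<And>x y. (x, y) \<in> le \<Longrightarrow> x \<in> P \<Longrightarrow> y \<in> P \<Longrightarrow> (f x, f y) \<in> le"
  shows "restrict f P \<in> poset_End P le"
  using assms by (auto simp: poset_End_def monotone_on_def)

text \<open>
  The map \<open>\<iota>\<close> on the points \<open>0, 1, \<dots>\<close> of the preorder is chosen one point at a time, while the
  points \<open>q 0, q 1, \<dots>\<close> of \<open>P\<close> are listed alternately with the values of \<open>\<iota>\<close> in one sequence \<open>w\<close>.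
  Interpolation lets \<open>\<iota> n\<close> be related to the earlier points of \<open>w\<close> only through earlier
  values of \<open>\<iota>\<close>.  Given a monotone \<open>k\<close>, an endomorphism extending it along \<open>\<iota>\<close> is then built along the
  same sequence: on \<open>\<iota> n\<close> it must take the value \<open>k n\<close>, which by the choice of \<open>\<iota>\<close> respects all
  earlier relations, and at \<open>q n\<close> only finitely many bounds have to be met.
\<close>

lemma free_map_nat:
  fixes T :: "nat \<Rightarrow> nat \<Rightarrow> bool"
  assumes ne: "P \<noteq> {}" and T_trans: "\<And>a b c. T a b \<Longrightarrow> T b c \<Longrightarrow> T a c"
  obtains \<iota> where "\<And>a. \<iota> a \<in> P" "\<And>a b. a \<noteq> b \<Longrightarrow> T a b \<Longrightarrow> (\<iota> a, \<iota> b) \<in> le"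
    "\<And>k. (\<And>a. k a \<in> P) \<Longrightarrow> (\<And>a b. T a b \<Longrightarrow> (k a, k b) \<in> le) \<Longrightarrow>
      \<exists>k'\<in>poset_End P le. \<forall>a. k' (\<iota> a) = k a"
proof -
  define q where "q = from_nat_into P"
  have qP: "q n \<in> P" for n using ne by (simp add: q_def from_nat_into)
  define good where "good w m z \<longleftrightarrow> z \<in> P \<and> (even m \<longrightarrow> z = q (m div 2)) \<and>
    (\<forall>n. m = 2 * n + 1 \<longrightarrow>
      (\<forall>i<n. T i n \<longrightarrow> (w (2 * i + 1), z) \<in> le) \<and>
      (\<forall>i<n. T n i \<longrightarrow> (z, w (2 * i + 1)) \<in> le) \<and>
      (\<forall>j<m. (w j, z) \<in> le \<longrightarrow> (\<exists>i<n. T i n \<and> (w j, w (2 * i + 1)) \<in> le)) \<and>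
      (\<forall>j<m. (z, w j) \<in> le \<longrightarrow> (\<exists>i<n. T n i \<and> (w (2 * i + 1), w j) \<in> le)))"
    for w :: "nat \<Rightarrow> 'p" and m z
  have "\<exists>w. \<forall>m. good w m (w m)"
  proof (rule dependent_wellorder_choice)
    fix r :: 'p and v w :: "nat \<Rightarrow> 'p" and m :: nat
    assume eq: "v y = w y" if "y < m" for y
    show "good v m r = good w m r"
      unfolding good_def by (intro conj_cong refl all_cong1 imp_cong) (auto simp: eq)
  next
    fix m :: nat and w :: "nat \<Rightarrow> 'p"
    assume prev: "good w y (w y)" if "y < m" for y
    show "\<exists>z. good w m z"
    proof (cases "even m")
      case True
      then show ?thesis using qP by (auto simp: good_def)
    next
      case False
      then obtain n where m: "m = 2 * n + 1" by (rule oddE)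
      define L where "L = {w (2 * i + 1) |i. i < n \<and> T i n}"
      define U where "U = {w (2 * i + 1) |i. i < n \<and> T n i}"
      have "w j \<in> P" if "j < m" for j using prev[OF that] by (simp add: good_def)
      then have D: "w ` {..<m} \<subseteq> P" by auto
      have idx: "2 * i + 1 < m" if "i < n" for i using that m by simp
      have LU: "(l, u) \<in> le" if lu: "l \<in> L" "u \<in> U" for l u
      proof -
        obtain i j where i: "l = w (2 * i + 1)" "i < n" "T i n"
          and j: "u = w (2 * j + 1)" "j < n" "T n j" using lu by (auto simp: L_def U_def)
        then have ij: "T i j" using T_trans by blast
        show ?thesis
          using prev[OF idx[OF i(2)]] prev[OF idx[OF j(2)]] ij i j
          by (cases i j rule: linorder_cases) (auto simp: good_def le_refl)
      qed
      have "\<exists>z\<in>P. (\<forall>l\<in>L. (l, z) \<in> le) \<and> (\<forall>u\<in>U. (z, u) \<in> le) \<and>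
        (\<forall>d\<in>w ` {..<m}. (d, z) \<in> le \<longrightarrow> (\<exists>l\<in>L. (d, l) \<in> le)) \<and>
        (\<forall>d\<in>w ` {..<m}. (z, d) \<in> le \<longrightarrow> (\<exists>u\<in>U. (u, d) \<in> le))"
        using D LU by (intro interpolate) (auto simp: L_def U_def m)
      then obtain z where z: "z \<in> P" "\<forall>l\<in>L. (l, z) \<in> le" "\<forall>u\<in>U. (z, u) \<in> le"
        "\<And>j. j < m \<Longrightarrow> (w j, z) \<in> le \<Longrightarrow> \<exists>l\<in>L. (w j, l) \<in> le"
        "\<And>j. j < m \<Longrightarrow> (z, w j) \<in> le \<Longrightarrow> \<exists>u\<in>U. (u, w j) \<in> le" by auto
      have "good w m z"
        unfolding good_def
      proof (intro conjI allI impI)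
        fix n' assume "m = 2 * n' + 1"
        then have [simp]: "n' = n" using m by simp
        show "(w (2 * i + 1), z) \<in> le" if "i < n'" "T i n'" for i
          using that z(2) by (auto simp: L_def)
        show "(z, w (2 * i + 1)) \<in> le" if "i < n'" "T n' i" for i
          using that z(3) by (auto simp: U_def)
        show "\<exists>i<n'. T i n' \<and> (w j, w (2 * i + 1)) \<in> le" if "j < m" "(w j, z) \<in> le" for j
          using z(4)[OF that] by (auto simp: L_def)
        show "\<exists>i<n'. T n' i \<and> (w (2 * i + 1), w j) \<in> le" if "j < m" "(z, w j) \<in> le" for j
          using z(5)[OF that] by (auto simp: U_def)
      qed (use z False in auto)
      then show ?thesis ..
    qed
  qed
  then obtain w where w: "\<And>m. good w m (w m)" by blast
  define \<iota> where "\<iota> n = w (2 * n + 1)" for n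
  have wP: "w m \<in> P" for m using w[of m] by (simp add: good_def)
  have w_even: "w (2 * n) = q n" for n using w[of "2 * n"] by (simp add: good_def)
  have down: "\<exists>i<n. T i n \<and> (w j, w (2 * i + 1)) \<in> le"
    if "j < 2 * n + 1" "(w j, w (2 * n + 1)) \<in> le" for j n
    using w[of "2 * n + 1"] that by (simp add: good_def)
  have up: "\<exists>i<n. T n i \<and> (w (2 * i + 1), w j) \<in> le"
    if "j < 2 * n + 1" "(w (2 * n + 1), w j) \<in> le" for j n
    using w[of "2 * n + 1"] that by (simp add: good_def)
  show ?thesis
  proof
    show "\<iota> a \<in> P" for a by (simp add: \<iota>_def wP)
    show "(\<iota> a, \<iota> b) \<in> le" if "a \<noteq> b" "T a b" for a b
      using w[of "2 * a + 1"] w[of "2 * b + 1"] that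
      by (cases a b rule: linorder_cases) (auto simp: good_def \<iota>_def)
    fix k assume kP: "\<And>a. k a \<in> P" and k_mono: "\<And>a b. T a b \<Longrightarrow> (k a, k b) \<in> le"
    define ext where "ext \<kappa> m z \<longleftrightarrow> z \<in> P \<and> (\<forall>n. m = 2 * n + 1 \<longrightarrow> z = k n) \<and>
      (\<forall>j<m. (w j, w m) \<in> le \<longrightarrow> (\<kappa> j, z) \<in> le) \<and>
      (\<forall>j<m. (w m, w j) \<in> le \<longrightarrow> (z, \<kappa> j) \<in> le)" for \<kappa> :: "nat \<Rightarrow> 'p" and m z
    have "\<exists>\<kappa>. \<forall>m. ext \<kappa> m (\<kappa> m)"
    proof (rule dependent_wellorder_choice)
      fix r :: 'p and v v' :: "nat \<Rightarrow> 'p" and m :: nat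
      assume "v y = v' y" if "y < m" for y
      then show "ext v m r = ext v' m r"
        unfolding ext_def by auto
    next
      fix m :: nat and \<kappa> :: "nat \<Rightarrow> 'p"
      assume prev: "ext \<kappa> y (\<kappa> y)" if "y < m" for y
      have \<kappa>P: "\<kappa> j \<in> P" if "j < m" for j using prev[OF that] by (simp add: ext_def)
      have \<kappa>_mono: "(\<kappa> i, \<kappa> j) \<in> le" if "i < m" "j < m" "(w i, w j) \<in> le" for i j
        using prev[OF that(1)] prev[OF that(2)] that(3) \<kappa>P[OF that(1)]
        by (cases i j rule: linorder_cases) (auto simp: ext_def le_refl)
      show "\<exists>z. ext \<kappa> m z"
      proof (cases "even m")
        case True
        define L where "L = {\<kappa> j |j. j < m \<and> (w j, w m) \<in> le}"
        define U where "U = {\<kappa> j |j. j < m \<and> (w m, w j) \<in> le}"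
        have "\<exists>z\<in>P. (\<forall>l\<in>L. (l, z) \<in> le) \<and> (\<forall>u\<in>U. (z, u) \<in> le)"
        proof (rule ex_between)
          show "finite L" "finite U" "L \<subseteq> P" "U \<subseteq> P" using \<kappa>P by (auto simp: L_def U_def)
          show "(l, u) \<in> le" if "l \<in> L" "u \<in> U" for l u
            using that \<kappa>_mono le_trans unfolding L_def U_def by blast
        qed
        then obtain z where "z \<in> P" "\<forall>l\<in>L. (l, z) \<in> le" "\<forall>u\<in>U. (z, u) \<in> le" by blast
        then have "ext \<kappa> m z" using True by (auto simp: ext_def L_def U_def)
        then show ?thesis ..
      next
        case False
        then obtain n where m: "m = 2 * n + 1" by (rule oddE)
        have \<kappa>_odd: "\<kappa> (2 * i + 1) = k i" and idx: "2 * i + 1 < m" if "i < n" for i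
          using prev[of "2 * i + 1"] that m by (auto simp: ext_def)
        have "ext \<kappa> m (k n)"
          unfolding ext_def
        proof (intro conjI allI impI)
          fix j assume j: "j < m" "(w j, w m) \<in> le"
          then obtain i where i: "i < n" "T i n" "(w j, w (2 * i + 1)) \<in> le"
            using down m by blast
          then have "(\<kappa> j, k i) \<in> le" using \<kappa>_mono[OF j(1) idx] \<kappa>_odd by simp
          then show "(\<kappa> j, k n) \<in> le" using k_mono i(2) le_trans by blast
        next
          fix j assume j: "j < m" "(w m, w j) \<in> le"
          then obtain i where i: "i < n" "T n i" "(w (2 * i + 1), w j) \<in> le"
            using up m by blast
          then have "(k i, \<kappa> j) \<in> le" using \<kappa>_mono[OF idx j(1)] \<kappa>_odd by simp
          then show "(k n, \<kappa> j) \<in> le" using k_mono i(2) le_trans by blast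
        qed (use kP m in auto)
        then show ?thesis ..
      qed
    qed
    then obtain \<kappa> where \<kappa>: "\<And>m. ext \<kappa> m (\<kappa> m)" by blast
    have \<kappa>P: "\<kappa> j \<in> P" for j using \<kappa>[of j] by (simp add: ext_def)
    have \<kappa>_mono: "(\<kappa> i, \<kappa> j) \<in> le" if "(w i, w j) \<in> le" for i j
      using \<kappa>[of i] \<kappa>[of j] that \<kappa>P[of i]
      by (cases i j rule: linorder_cases) (auto simp: ext_def le_refl)
    \<comment> \<open>Points may occur repeatedly in \<open>w\<close>; by antisymmetry \<open>\<kappa>\<close> does not notice.\<close>
    have \<kappa>_cong: "\<kappa> i = \<kappa> j" if "w i = w j" for i j
      using \<kappa>_mono[of i j] \<kappa>_mono[of j i] that wP le_refl le_antisym by metis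
    define k' where "k' = (\<lambda>x\<in>P. \<kappa> (2 * to_nat_on P x))"
    have w_index: "w (2 * to_nat_on P x) = x" if "x \<in> P" for x
      using that countable_carrier by (simp add: w_even q_def)
    have "k' \<in> poset_End P le"
      unfolding k'_def by (rule poset_EndI) (auto simp: \<kappa>P w_index intro: \<kappa>_mono)
    moreover have "k' (\<iota> a) = k a" for a
    proof -
      have "k' (\<iota> a) = \<kappa> (2 * a + 1)"
        by (auto simp: k'_def \<iota>_def wP w_index intro: \<kappa>_cong)
      also have "\<dots> = k a" using \<kappa>[of "2 * a + 1"] by (simp add: ext_def)
      finally show ?thesis .
    qed
    ultimately show "\<exists>k'\<in>poset_End P le. \<forall>a. k' (\<iota> a) = k a" by blast
  qed
qed

lemma free_map_into_poset:
  fixes T :: "'t::countable \<Rightarrow> 't \<Rightarrow> bool"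
  assumes "P \<noteq> {}" and T_trans: "\<And>a b c. T a b \<Longrightarrow> T b c \<Longrightarrow> T a c"
  obtains \<iota> where "\<And>a. \<iota> a \<in> P" "\<And>a b. T a b \<Longrightarrow> (\<iota> a, \<iota> b) \<in> le"
    "\<And>k. (\<And>a. k a \<in> P) \<Longrightarrow> (\<And>a b. T a b \<Longrightarrow> (k a, k b) \<in> le) \<Longrightarrow>
      \<exists>k'\<in>poset_End P le. \<forall>a. k' (\<iota> a) = k a"
proof -
  define T' where "T' m n \<longleftrightarrow> (\<exists>a b. m = to_nat a \<and> n = to_nat b \<and> T a b)" for m n
  obtain \<iota> where \<iota>: "\<And>a. \<iota> a \<in> P" "\<And>a b. a \<noteq> b \<Longrightarrow> T' a b \<Longrightarrow> (\<iota> a, \<iota> b) \<in> le"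
    and ext: "\<And>k. (\<And>a. k a \<in> P) \<Longrightarrow> (\<And>a b. T' a b \<Longrightarrow> (k a, k b) \<in> le) \<Longrightarrow>
      \<exists>k'\<in>poset_End P le. \<forall>a. k' (\<iota> a) = k a"
    by (rule free_map_nat[of T']) (use assms in \<open>auto simp: T'_def\<close>)
  show ?thesis
  proof
    show "\<iota> (to_nat a) \<in> P" for a :: 't by (rule \<iota>)
    show "(\<iota> (to_nat a), \<iota> (to_nat b)) \<in> le" if "T a b" for a b
      using that \<iota> le_refl by (cases "a = b") (auto simp: T'_def)
    fix k :: "'t \<Rightarrow> 'p"
    assume k: "\<And>a. k a \<in> P" "\<And>a b. T a b \<Longrightarrow> (k a, k b) \<in> le"
    have "\<exists>k'\<in>poset_End P le. \<forall>a. k' (\<iota> a) = k (from_nat a)"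
      by (rule ext) (auto simp: k T'_def)
    then show "\<exists>k'\<in>poset_End P le. \<forall>a. k' (\<iota> (to_nat a)) = k a"
      by (metis from_nat_to_nat)
  qed
qed

section \<open>Independent endomorphisms and automatic continuity\<close>

text \<open>
  A binary word of length \<open>n\<close> stands for a copy of the \<open>n\<close>-th point of \<open>P\<close>.  Points are compared as
  in \<open>P\<close>, but only via a common prefix; so the branch of an infinite sequence is a copy of
  \<open>P\<close>, and two branches are amalgamated freely over their common part.  On the
  words that extend the shortest prefix of \<open>y\<close> which is not a prefix of \<open>x\<close> the connecting map acts
  as \<open>g\<close>, on all others as \<open>f\<close>.
\<close>

lemma independent_endomorphisms:
  assumes ne: "P \<noteq> {}"
  obtains e :: "(nat \<Rightarrow> bool) \<Rightarrow> 'p \<Rightarrow> 'p" where "\<And>x. e x \<in> poset_End P le"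
    "\<And>x y n f g. \<lbrakk>\<And>i. i < n \<Longrightarrow> x i = y i; x n \<noteq> y n; f \<in> poset_End P le; g \<in> poset_End P le;
       \<And>i. i \<le> n \<Longrightarrow> g (from_nat_into P i) = f (from_nat_into P i)\<rbrakk> \<Longrightarrow>
       \<exists>k\<in>poset_End P le. compose P k (e x) = f \<and> compose P k (e y) = g"
proof -
  define p where "p = from_nat_into P"
  have pP: "p n \<in> P" for n using ne by (simp add: p_def from_nat_into)
  have p_index: "p (to_nat_on P a) = a" if "a \<in> P" for a
    using that countable_carrier by (simp add: p_def)
  define T where "T s t \<longleftrightarrow> (\<exists>u. prefix u s \<and> prefix u t \<and>
    (p (length s), p (length u)) \<in> le \<and> (p (length u), p (length t)) \<in> le)" for s t :: "bool list"
  have T_trans: "T s r" if "T s t" "T t r" for s t r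
  proof -
    obtain u v where u: "prefix u s" "prefix u t" "(p (length s), p (length u)) \<in> le"
        "(p (length u), p (length t)) \<in> le"
      and v: "prefix v t" "prefix v r" "(p (length t), p (length v)) \<in> le"
        "(p (length v), p (length r)) \<in> le" using \<open>T s t\<close> \<open>T t r\<close> by (auto simp: T_def)
    consider "prefix u v" | "prefix v u" using prefix_same_cases[OF u(2) v(1)] by blast
    then show ?thesis
    proof cases
      case 1
      then show ?thesis unfolding T_def
        using u v le_trans prefix_order.trans by (intro exI[of _ u]) blast
    next
      case 2
      then show ?thesis unfolding T_def
        using u v le_trans prefix_order.trans by (intro exI[of _ v]) blast
    qed
  qed
  obtain \<iota> where \<iota>P: "\<And>s. \<iota> s \<in> P" and \<iota>_mono: "\<And>s t. T s t \<Longrightarrow> (\<iota> s, \<iota> t) \<in> le"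
    and ext: "\<And>k. (\<And>s. k s \<in> P) \<Longrightarrow> (\<And>s t. T s t \<Longrightarrow> (k s, k t) \<in> le) \<Longrightarrow>
      \<exists>k'\<in>poset_End P le. \<forall>s. k' (\<iota> s) = k s"
    by (rule free_map_into_poset[of T, OF ne]) (erule (1) T_trans, blast)
  define word :: "(nat \<Rightarrow> bool) \<Rightarrow> 'p \<Rightarrow> bool list"
    where "word x a = map x [0..<to_nat_on P a]" for x a
  define e where "e x = (\<lambda>a\<in>P. \<iota> (word x a))" for x
  have prefix_map: "prefix (map x [0..<m]) (map x [0..<n])" if "m \<le> n" for x :: "nat \<Rightarrow> bool" and m n
    using upt_add_eq_append[of 0 m "n - m"] that by (auto simp: prefix_def)
  have p_word: "p (length (word x a)) = a" if "a \<in> P" for x a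
    using that by (simp add: word_def p_index)
  show ?thesis
  proof
    fix x :: "nat \<Rightarrow> bool"
    show "e x \<in> poset_End P le"
      unfolding e_def
    proof (rule poset_EndI)
      fix a b assume ab: "(a, b) \<in> le" "a \<in> P" "b \<in> P"
      consider "prefix (word x a) (word x b)" | "prefix (word x b) (word x a)"
        unfolding word_def using prefix_map linear[of "to_nat_on P a" "to_nat_on P b"] by blast
      then have "T (word x a) (word x b)"
      proof cases
        case 1
        then show ?thesis unfolding T_def
          by (intro exI[of _ "word x a"]) (simp add: p_word ab le_refl)
      next
        case 2
        then show ?thesis unfolding T_def
          by (intro exI[of _ "word x b"]) (simp add: p_word ab le_refl)
      qed
      then show "(\<iota> (word x a), \<iota> (word x b)) \<in> le" by (rule \<iota>_mono)
    qed (rule \<iota>P)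
  next
    fix x y :: "nat \<Rightarrow> bool" and n f g
    assume xy: "\<And>i. i < n \<Longrightarrow> x i = y i" "x n \<noteq> y n"
      and f: "f \<in> poset_End P le" and g: "g \<in> poset_End P le"
      and fg: "\<And>i. i \<le> n \<Longrightarrow> g (from_nat_into P i) = f (from_nat_into P i)"
    define v where "v = map y [0..<Suc n]"
    define k where "k s = (if prefix v s then g else f) (p (length s))" for s
    have mono: "(j a, j b) \<in> le" if "j = f \<or> j = g" "a \<in> P" "b \<in> P" "(a, b) \<in> le" for j a b
      using that f g by (auto simp: poset_End_def monotone_on_def)
    have "f a \<in> P \<and> g a \<in> P" if "a \<in> P" for a using that f g by (auto simp: poset_End_def)
    then have kP: "k s \<in> P" for s by (simp add: k_def pP)
    have k_between: "k s = f (p (length s)) \<and> k u = f (p (length u)) \<or>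
        k s = g (p (length s)) \<and> k u = g (p (length u))" if "prefix u s" for u s
    proof (cases "prefix v s \<and> \<not> prefix v u")
      case True
      \<comment> \<open>Here \<open>u\<close> is a proper prefix of \<open>v\<close>, hence so short that \<open>f\<close> and \<open>g\<close> agree on its point.\<close>
      then have "length u < length v"
        using prefix_length_prefix[of v s u] that by (meson not_le_imp_less)
      then have "length u \<le> n" by (simp add: v_def)
      then show ?thesis using True fg by (simp add: k_def p_def)
    next
      case False
      then show ?thesis using that prefix_order.trans by (auto simp: k_def)
    qed
    have "(k s, k t) \<in> le" if st: "T s t" for s t
    proof -
      obtain u where u: "prefix u s" "prefix u t" "(p (length s), p (length u)) \<in> le"
        "(p (length u), p (length t)) \<in> le" using st by (auto simp: T_def)
      have "(k s, k u) \<in> le" using k_between[OF u(1)] mono u(3) pP by metis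
      moreover have "(k u, k t) \<in> le" using k_between[OF u(2)] mono u(4) pP by metis
      ultimately show ?thesis by (rule le_trans)
    qed
    then obtain k' where k': "k' \<in> poset_End P le" "\<And>s. k' (\<iota> s) = k s"
      using ext[of k] kP by blast
    have not_v: "\<not> prefix v (word x a)" for a
    proof
      assume pre: "prefix v (word x a)"
      then have "Suc n \<le> to_nat_on P a"
        using prefix_length_le[OF pre] by (simp add: v_def word_def)
      moreover obtain zs where "word x a = v @ zs" using pre by (auto simp: prefix_def)
      then have "word x a ! n = v ! n" by (simp add: v_def nth_append del: upt_Suc)
      ultimately show False using xy(2) by (simp add: v_def word_def del: upt_Suc)
    qed
    have "k (word x a) = f a" if "a \<in> P" for a
      using not_v that by (simp add: k_def p_word)
    moreover have "k (word y a) = g a" if "a \<in> P" for a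
    proof (cases "to_nat_on P a \<le> n")
      case True
      then have "g a = f a" using fg[OF True] that countable_carrier by simp
      then show ?thesis using that by (simp add: k_def p_word)
    next
      case False
      then have "prefix v (word y a)" unfolding v_def word_def by (intro prefix_map) simp
      then show ?thesis using that by (simp add: k_def p_word)
    qed
    moreover have "f a = undefined" "g a = undefined" if "a \<notin> P" for a
      using that f g by (auto simp: poset_End_def)
    ultimately have "compose P k' (e x) a = f a" "compose P k' (e y) a = g a" for a
      by (cases "a \<in> P"; simp add: compose_def e_def k'(2))+
    then have "compose P k' (e x) = f" "compose P k' (e y) = g" by blast+
    then show "\<exists>k\<in>poset_End P le. compose P k (e x) = f \<and> compose P k (e y) = g"
      using k' by blast
  qed
qed

text \<open>
  If no initial part of \<open>f\<close> determined \<open>h f b\<close>, every \<open>n\<close> would have a witness \<open>g n\<close> agreeing with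
  \<open>f\<close> up to \<open>n\<close>.  Two independent endomorphisms whose images under \<open>h\<close> agree at \<open>b\<close> refute the witness
  for the place where their index sequences part.
\<close>

lemma hom_locally_constant:
  assumes hom: "\<And>f g. f \<in> poset_End P le \<Longrightarrow> g \<in> poset_End P le \<Longrightarrow>
      h (compose P f g) = compose B (h f) (h g)"
    and hB: "\<And>f. f \<in> poset_End P le \<Longrightarrow> h f \<in> B \<rightarrow> B"
    and "countable B" and f: "f \<in> poset_End P le" and b: "b \<in> B"
  shows "\<exists>F. finite F \<and> F \<subseteq> P \<and> (\<forall>g\<in>poset_End P le. (\<forall>x\<in>F. g x = f x) \<longrightarrow> h g b = h f b)"
proof (cases "P = {}")
  case True
  then have "g = f" if "g \<in> poset_End P le" for g
    using that f by (auto simp: poset_End_def)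
  then show ?thesis by blast
next
  case ne: False
  show ?thesis
  proof (rule ccontr)
    assume no: "\<not> ?thesis"
    have "\<exists>g\<in>poset_End P le. (\<forall>i\<le>n. g (from_nat_into P i) = f (from_nat_into P i)) \<and> h g b \<noteq> h f b"
      for n
    proof (rule ccontr)
      assume "\<not> ?thesis"
      then have "finite (from_nat_into P ` {..n}) \<and> from_nat_into P ` {..n} \<subseteq> P \<and>
        (\<forall>g\<in>poset_End P le. (\<forall>x\<in>from_nat_into P ` {..n}. g x = f x) \<longrightarrow> h g b = h f b)"
        using ne by (auto intro: from_nat_into)
      then show False using no by blast
    qed
    then obtain g where g: "\<And>n. g n \<in> poset_End P le"
        "\<And>n i. i \<le> n \<Longrightarrow> g n (from_nat_into P i) = f (from_nat_into P i)"
        "\<And>n. h (g n) b \<noteq> h f b"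
      by metis
    obtain e :: "(nat \<Rightarrow> bool) \<Rightarrow> 'p \<Rightarrow> 'p" where e: "\<And>x. e x \<in> poset_End P le"
      and common: "\<And>x y n f g. \<lbrakk>\<And>i. i < n \<Longrightarrow> x i = y i; x n \<noteq> y n; f \<in> poset_End P le;
         g \<in> poset_End P le; \<And>i. i \<le> n \<Longrightarrow> g (from_nat_into P i) = f (from_nat_into P i)\<rbrakk> \<Longrightarrow>
         \<exists>k\<in>poset_End P le. compose P k (e x) = f \<and> compose P k (e y) = g"
      using independent_endomorphisms[OF ne] by blast
    have "\<not> inj (\<lambda>x. h (e x) b)"
    proof
      assume inj: "inj (\<lambda>x. h (e x) b)"
      have "inj (\<lambda>x. to_nat_on B (h (e x) b))"
        by (rule injI) (use hB e b \<open>countable B\<close> inj in \<open>auto dest!: injD simp: Pi_iff\<close>)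
      then have "inj ((\<lambda>x. to_nat_on B (h (e x) b)) \<circ> (\<lambda>A i. i \<in> A))"
        by (rule inj_compose) (auto simp: inj_def fun_eq_iff)
      then obtain d :: "nat \<Rightarrow> nat set" where "surj d" using inj_imp_surj_inv by blast
      then show False using Cantors_theorem[of "UNIV :: nat set"] by auto
    qed
    then obtain x y where eq: "h (e x) b = h (e y) b" and "x \<noteq> y" by (auto simp: inj_def)
    define n where "n = (LEAST n. x n \<noteq> y n)"
    have "\<exists>n. x n \<noteq> y n" using \<open>x \<noteq> y\<close> by auto
    then have "x n \<noteq> y n" unfolding n_def by (rule LeastI_ex)
    moreover have "x i = y i" if "i < n" for i
      using not_less_Least[OF that[unfolded n_def]] by simp
    ultimately obtain k where k: "k \<in> poset_End P le" "compose P k (e x) = f" "compose P k (e y) = g n"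
      using common[of n x y f "g n"] f g by blast
    have "h f b = h k (h (e x) b)" using hom[OF k(1) e, of x] k b by (simp add: compose_eq)
    also have "\<dots> = h (g n) b" using hom[OF k(1) e, of y] k b eq by (simp add: compose_eq)
    finally show False using g(3)[of n] by simp
  qed
qed

end

section \<open>Pointwise convergence and weak orbits\<close>

lemma topspace_pointwise_topology: "M \<subseteq> A \<rightarrow>\<^sub>E A \<Longrightarrow> topspace (pointwise_topology A M) = M"
  by (auto simp: pointwise_topology_def)

lemma continuous_map_pointwise_topology:
  assumes M: "M \<subseteq> A \<rightarrow>\<^sub>E A" and N: "N \<subseteq> B \<rightarrow>\<^sub>E B" and \<phi>: "\<phi> ` M \<subseteq> N"
    and loc: "\<And>f b. f \<in> M \<Longrightarrow> b \<in> B \<Longrightarrow>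
      \<exists>F. finite F \<and> F \<subseteq> A \<and> (\<forall>g\<in>M. (\<forall>x\<in>F. g x = f x) \<longrightarrow> \<phi> g b = \<phi> f b)"
  shows "continuous_map (pointwise_topology A M) (pointwise_topology B N) \<phi>"
proof -
  have top: "topspace (pointwise_topology A M) = M"
    using M by (rule topspace_pointwise_topology)
  have open_eval: "openin (pointwise_topology A M) {f \<in> M. f a = c}" if "a \<in> A" for a c
  proof -
    have "continuous_map (pointwise_topology A M) (discrete_topology A) (\<lambda>f. f a)"
      unfolding pointwise_topology_def
      using continuous_map_product_projection[OF that, of "\<lambda>_. discrete_topology A"]
      by (rule continuous_map_from_subtopology)
    then have "openin (pointwise_topology A M)
      {f \<in> topspace (pointwise_topology A M). f a \<in> {c} \<inter> A}"
      by (rule openin_continuous_map_preimage) simp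
    then have "openin (pointwise_topology A M) {f \<in> M. f a \<in> {c} \<inter> A}"
      by (simp only: top)
    moreover have "{f \<in> M. f a \<in> {c} \<inter> A} = {f \<in> M. f a = c}"
      using M that by auto
    ultimately show ?thesis by simp
  qed
  have coord: "continuous_map (pointwise_topology A M) (discrete_topology B) (\<lambda>f. \<phi> f b)"
    if b: "b \<in> B" for b
    unfolding continuous_map_def top
  proof (intro conjI allI impI)
    show "(\<lambda>f. \<phi> f b) \<in> M \<rightarrow> topspace (discrete_topology B)"
      using \<phi> N b by (auto simp: image_subset_iff PiE_iff)
    fix V :: "'b set"
    show "openin (pointwise_topology A M) {f \<in> M. \<phi> f b \<in> V}"
    proof (subst openin_subopen, safe)
      fix f assume f: "f \<in> M" "\<phi> f b \<in> V"
      obtain F where F: "finite F" "F \<subseteq> A" "\<forall>g\<in>M. (\<forall>x\<in>F. g x = f x) \<longrightarrow> \<phi> g b = \<phi> f b"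
        using loc[OF f(1) b] by blast
      let ?W = "topspace (pointwise_topology A M) \<inter> (\<Inter>x\<in>F. {g \<in> M. g x = f x})"
      have "openin (pointwise_topology A M) ?W"
      proof (cases "F = {}")
        case False
        then show ?thesis
          using F open_eval by (intro openin_Int openin_topspace openin_INT2) auto
      qed simp
      moreover have "f \<in> ?W" unfolding top using f(1) by simp
      moreover have "?W \<subseteq> {f \<in> M. \<phi> f b \<in> V}"
      proof
        fix g assume "g \<in> ?W"
        then have "g \<in> M" "\<forall>x\<in>F. g x = f x" unfolding top by auto
        then show "g \<in> {f \<in> M. \<phi> f b \<in> V}" using F(3) f(2) by simp
      qed
      ultimately show "\<exists>W. openin (pointwise_topology A M) W \<and> f \<in> W \<and> W \<subseteq> {f \<in> M. \<phi> f b \<in> V}"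
        by blast
    qed
  qed
  have "continuous_map (pointwise_topology A M) (product_topology (\<lambda>_. discrete_topology B) B) \<phi>"
  proof (rule continuous_map_coordinatewise_then_product)
    fix i f assume "i \<notin> B" "f \<in> topspace (pointwise_topology A M)"
    moreover from this have "\<phi> f \<in> B \<rightarrow>\<^sub>E B" unfolding top using \<phi> N by blast
    ultimately show "\<phi> f i = undefined" by auto
  qed (rule coord)
  then show ?thesis
    unfolding pointwise_topology_def[of B N]
    by (rule continuous_map_into_subtopology) (use \<phi> in \<open>auto simp only: top image_subset_iff Pi_iff\<close>)
qed

text \<open>
  The kernel of \<open>z\<close> on \<open>B\<close> is one of the equivalence relations whose intersection is the weak orbit
  relation.
\<close>

lemma left_zero_constant_on_weak_orbits:
  assumes "\<And>m b. m \<in> M \<Longrightarrow> b \<in> B \<Longrightarrow> z (m b) = z b" and "(a, b) \<in> weak_orbit_rel B M"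
  shows "z a = z b"
proof -
  let ?E = "{(a, b). a \<in> B \<and> b \<in> B \<and> z a = z b}"
  have "equiv B ?E" by (rule equivI) (auto simp: refl_on_def sym_def trans_def)
  moreover have "weak_orbit_le B M \<subseteq> ?E" using assms(1) by (auto simp: weak_orbit_le_def)
  ultimately show ?thesis using assms(2) unfolding weak_orbit_rel_def by blast
qed

lemma finite_weak_orbit_representatives:
  assumes "finite (weak_orbits B M)" and "\<And>m. m \<in> M \<Longrightarrow> m \<in> B \<rightarrow> B"
  obtains Q where "finite Q" "Q \<subseteq> B" "\<And>b. b \<in> B \<Longrightarrow> \<exists>r\<in>Q. (b, r) \<in> weak_orbit_rel B M"
proof
  let ?rep = "\<lambda>X. SOME b. b \<in> X"
  have "equiv B (B \<times> B)" by (rule equivI) (auto simp: refl_on_def sym_def trans_def)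
  then have sub: "weak_orbit_rel B M \<subseteq> B \<times> B"
    unfolding weak_orbit_rel_def by (auto simp: weak_orbit_le_def)
  have "(b, b) \<in> weak_orbit_rel B M" if "b \<in> B" for b
    using that by (auto simp: weak_orbit_rel_def equiv_def refl_on_def)
  then have rep: "(b, ?rep (weak_orbit_rel B M `` {b})) \<in> weak_orbit_rel B M" if "b \<in> B" for b
    using that someI[of "\<lambda>c. c \<in> weak_orbit_rel B M `` {b}" b] by simp
  show "finite (?rep ` weak_orbits B M)" using assms(1) by simp
  show "?rep ` weak_orbits B M \<subseteq> B"
  proof
    fix r assume "r \<in> ?rep ` weak_orbits B M"
    then obtain b where "b \<in> B" "r = ?rep (weak_orbit_rel B M `` {b})"
      by (auto simp: weak_orbits_def quotient_def)
    then show "r \<in> B" using rep sub by blast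
  qed
  show "\<exists>r\<in>?rep ` weak_orbits B M. (b, r) \<in> weak_orbit_rel B M" if "b \<in> B" for b
    using rep[OF that] quotientI[OF that, of "weak_orbit_rel B M"]
    unfolding weak_orbits_def by blast
qed

section \<open>Automatic homeomorphicity\<close>

theorem theorem4p15:
  fixes P :: "'p set" and le :: "'p rel"
    and B :: "'b set" and S :: "'s set" and ar :: "'s \<Rightarrow> nat" and R :: "'s \<Rightarrow> 'b list set"
    and h :: "('p \<Rightarrow> 'p) \<Rightarrow> ('b \<Rightarrow> 'b)"
  assumes "countable_universal_homogeneous_poset P le"
    and "relational_structure B S ar R"
    and "countable B"
    and "finite (weak_orbits B (structure_End B S R))"
    and "h \<in> iso (transf_monoid P (poset_End P le)) (transf_monoid B (structure_End B S R))"
  shows "homeomorphic_map (pointwise_topology P (poset_End P le))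
           (pointwise_topology B (structure_End B S R)) h"
proof -
  interpret interpolating_poset P le
    using assms(1) by (rule interpolating_poset_if_universal_homogeneous)
  let ?M = "poset_End P le" and ?N = "structure_End B S R"
  have M: "?M \<subseteq> P \<rightarrow>\<^sub>E P" by (auto simp: poset_End_def)
  have N: "?N \<subseteq> B \<rightarrow>\<^sub>E B" by (auto simp: structure_End_def)
  have hom: "h (compose P f g) = compose B (h f) (h g)" if "f \<in> ?M" "g \<in> ?M" for f g
    using assms(5) that by (auto simp: iso_def hom_def transf_monoid_def)
  have bij: "bij_betw h ?M ?N"
    using assms(5) by (simp add: iso_def transf_monoid_def)
  then have hN: "h f \<in> ?N" if "f \<in> ?M" for f using that by (auto simp: bij_betw_def)
  have hB: "h f \<in> B \<rightarrow> B" if "f \<in> ?M" for f using hN[OF that] N by (auto simp: PiE_def)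
  define h' where "h' = inv_into ?M h"
  have h'M: "h' f \<in> ?M" and hh': "h (h' f) = f" if "f \<in> ?N" for f
    using that bij by (auto simp: h'_def bij_betw_def inv_into_into f_inv_into_f)
  have h'h: "h' (h f) = f" if "f \<in> ?M" for f
    using that bij by (auto simp: h'_def bij_betw_def)
  have "continuous_map (pointwise_topology P ?M) (pointwise_topology B ?N) h"
  proof (rule continuous_map_pointwise_topology[OF M N])
    show "h ` ?M \<subseteq> ?N" using hN by blast
  qed (rule hom_locally_constant[OF hom hB assms(3)])
  moreover have "continuous_map (pointwise_topology B ?N) (pointwise_topology P ?M) h'"
  proof (rule continuous_map_pointwise_topology[OF N M])
    show "h' ` ?N \<subseteq> ?M" using h'M by auto
    fix f p assume f: "f \<in> ?N" and p: "p \<in> P"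
    define c where "c = (\<lambda>x\<in>P. p)"
    have c: "c \<in> ?M" unfolding c_def using p le_refl by (intro poset_EndI) auto
    have c_zero: "compose P c g = c" if "g \<in> ?M" for g
      using that M by (auto simp: compose_def c_def fun_eq_iff PiE_iff)
    have zero: "h c (m b) = h c b" if m: "m \<in> ?N" and b: "b \<in> B" for m b
      using hom[OF c h'M[OF m]] c_zero[OF h'M[OF m]] hh'[OF m] b by (metis compose_eq)
    obtain Q where Q: "finite Q" "Q \<subseteq> B" "\<And>b. b \<in> B \<Longrightarrow> \<exists>r\<in>Q. (b, r) \<in> weak_orbit_rel B ?N"
      using finite_weak_orbit_representatives[OF assms(4)] N by (auto simp: PiE_iff subset_iff Pi_iff)
    have const: "h c a = h c b" if "(a, b) \<in> weak_orbit_rel B ?N" for a b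
      using zero that by (rule left_zero_constant_on_weak_orbits)
    have "h' g p = h' f p" if g: "g \<in> ?N" and eq: "\<forall>x\<in>h c ` Q. g x = f x" for g
    proof -
      have "g (h c b) = f (h c b)" if b: "b \<in> B" for b
      proof -
        obtain r where "r \<in> Q" "(b, r) \<in> weak_orbit_rel B ?N" using Q(3)[OF b] by blast
        then show ?thesis using const eq by (metis imageI)
      qed
      then have "compose B g (h c) = compose B f (h c)"
        by (auto simp: compose_def fun_eq_iff)
      then have "h (compose P (h' g) c) = h (compose P (h' f) c)"
        using hom c f g h'M hh' by simp
      moreover have "compose P (h' m) c \<in> ?M" if "m \<in> ?N" for m
      proof -
        have "h' m p \<in> P" using h'M[OF that] M p by auto
        then show ?thesis unfolding compose_def c_def
          using p le_refl by (intro poset_EndI) auto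
      qed
      ultimately have "compose P (h' g) c = compose P (h' f) c"
        using bij f g by (metis h'h)
      then show ?thesis using p by (metis c_def compose_eq restrict_apply')
    qed
    moreover have "finite (h c ` Q)" "h c ` Q \<subseteq> B" using Q hB[OF c] by auto
    ultimately show "\<exists>F. finite F \<and> F \<subseteq> B \<and> (\<forall>g\<in>?N. (\<forall>x\<in>F. g x = f x) \<longrightarrow> h' g p = h' f p)"
      by blast
  qed
  ultimately have "homeomorphic_maps (pointwise_topology P ?M) (pointwise_topology B ?N) h h'"
    using h'h hh' by (simp add: homeomorphic_maps_def topspace_pointwise_topology M N)
  then show ?thesis using homeomorphic_map_maps by blast
qed

end
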